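(* Let $X$ be a sequentially complete locally convex space and let $\mathcal{P}$ be a calibration on $X$. If $T\in (Q_{\mathcal{P}}(X))_0$ and $\lambda\in\mathbb{C}$ satisfies $|\lambda|>r_{\mathcal{P}}(T)$, then the Neumann series $\sum_{n=0}^{\infty}\frac{T^n}{\lambda^{n+1}}$ converges in $Q_{\mathcal{P}}(X)$ to $R(\lambda,T)=(\lambda I-T)^{-1}$, and $R(\lambda,T)\in Q_{\mathcal{P}}(X)$.
   Context: All locally convex spaces are Hausdorff over $\mathbb{C}$ and all operators are linear. A calibration on a locally convex space $X$ is a family $\mathcal{P}$ of seminorms generating the topology of $X$, i.e. the sets $\{x\in X: p(x)<\varepsilon\}$ ($p\in\mathcal{P}$, $\varepsilon>0$) form a neighborhood sub-base at $0$. An operator $T:X\to X$ is quotient bounded with respect to $\mathcal{P}$ if for every $p\in\mathcal{P}$ there is $c_p>0$ with $p(Tx)\le c_p\,p(x)$ for all $x\in X$; $Q_{\mathcal{P}}(X)$ denotes the algebra of all such operators. For $p\in\mathcal{P}$ and $T\in Q_{\mathcal{P}}(X)$ put $\hat p(T)=\inf\{r>0: p(Tx)\le r\,p(x)\ \forall x\in X\}$; $Q_{\mathcal{P}}(X)$ carries the topology generated by the seminorms $\hat p$, $p\in\mathcal{P}$, and boundedness and convergence in $Q_{\mathcal{P}}(X)$ refer to this topology. The $\mathcal{P}$-spectral radius of $T$ is $r_{\mathcal{P}}(T)=\inf\{\alpha>0: \text{the set } \{(\alpha^{-1}T)^n\}_{n\ge1}\text{ is bounded in }Q_{\mathcal{P}}(X)\}\in[0,\infty]$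 (with $\inf\emptyset=\infty$). $(Q_{\mathcal{P}}(X))_0$ is the set of bounded elements of $Q_{\mathcal{P}}(X)$, i.e. those $T$ for which $\{(cT)^n\}_{n\ge1}$ is bounded in $Q_{\mathcal{P}}(X)$ for some nonzero scalar $c$. *)

theory Defs
  imports "HOL-Analysis.Analysis"
begin

(* The library has no class of complex vector spaces, so the scalar multiplication is an explicit
   parameter of the library locale vector_space.  Addition, the topology and the Hausdorff
   property come from the type classes. *)

definition complex_convex :: "(complex \<Rightarrow> 'a::ab_group_add \<Rightarrow> 'a) \<Rightarrow> 'a set \<Rightarrow> bool" where
  "complex_convex cscale V \<longleftrightarrow>
     (\<forall>x\<in>V. \<forall>y\<in>V. \<forall>t::real. 0 \<le> t \<and> t \<le> 1 \<longrightarrow>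
        cscale (of_real t) x + cscale (of_real (1 - t)) y \<in> V)"

locale locally_convex_space = vector_space cscale
  for cscale :: "complex \<Rightarrow> 'a::{topological_ab_group_add, t2_space} \<Rightarrow> 'a" +
  assumes continuous_scale: "continuous_on UNIV (\<lambda>(c, x). cscale c x)"
    and locally_convex:
      "\<And>U. open U \<Longrightarrow> 0 \<in> U \<Longrightarrow> \<exists>V. open V \<and> 0 \<in> V \<and> V \<subseteq> U \<and> complex_convex cscale V"

definition tvs_Cauchy :: "(nat \<Rightarrow> 'a::{topological_ab_group_add, t2_space}) \<Rightarrow> bool" where
  "tvs_Cauchy u \<longleftrightarrow>
     (\<forall>U. open U \<and> 0 \<in> U \<longrightarrow> (\<exists>N. \<forall>m\<ge>N. \<forall>n\<ge>N. u m - u n \<in> U))"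

definition sequentially_complete :: "'a::{topological_ab_group_add, t2_space} itself \<Rightarrow> bool" where
  "sequentially_complete TYPE('a) \<longleftrightarrow> (\<forall>u :: nat \<Rightarrow> 'a. tvs_Cauchy u \<longrightarrow> convergent u)"

definition is_seminorm :: "(complex \<Rightarrow> 'a::ab_group_add \<Rightarrow> 'a) \<Rightarrow> ('a \<Rightarrow> real) \<Rightarrow> bool" where
  "is_seminorm cscale p \<longleftrightarrow>
     (\<forall>x. 0 \<le> p x) \<and> (\<forall>x y. p (x + y) \<le> p x + p y) \<and> (\<forall>c x. p (cscale c x) = cmod c * p x)"

(* The last two conjuncts say that the sets {x. p x < e} form a neighbourhood sub-base at 0:
   they are neighbourhoods of 0, and every neighbourhood of 0 contains a finite intersection of
   them. *)
definition calibration ::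
  "(complex \<Rightarrow> 'a::{topological_ab_group_add, t2_space} \<Rightarrow> 'a) \<Rightarrow> ('a \<Rightarrow> real) set \<Rightarrow> bool" where
  "calibration cscale P \<longleftrightarrow>
     (\<forall>p\<in>P. is_seminorm cscale p) \<and>
     (\<forall>p\<in>P. \<forall>e>0. \<exists>U. open U \<and> 0 \<in> U \<and> U \<subseteq> {x. p x < e}) \<and>
     (\<forall>U. open U \<and> 0 \<in> U \<longrightarrow>
        (\<exists>F. finite F \<and> F \<subseteq> P \<times> {0<..} \<and> (\<Inter>(p, e)\<in>F. {x. p x < e}) \<subseteq> U))"

definition quotient_bounded ::
  "(complex \<Rightarrow> 'a::ab_group_add \<Rightarrow> 'a) \<Rightarrow> ('a \<Rightarrow> real) set \<Rightarrow> ('a \<Rightarrow> 'a) set" where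
  "quotient_bounded cscale P =
     {T. Vector_Spaces.linear cscale cscale T \<and> (\<forall>p\<in>P. \<exists>c>0. \<forall>x. p (T x) \<le> c * p x)}"

definition op_seminorm :: "('a \<Rightarrow> real) \<Rightarrow> ('a \<Rightarrow> 'a) \<Rightarrow> real" where
  "op_seminorm p T = Inf {r. r > 0 \<and> (\<forall>x. p (T x) \<le> r * p x)}"

(* The whole space is listed among the generators so that it is the topspace even for P = {}. *)
definition qb_topology ::
  "(complex \<Rightarrow> 'a::ab_group_add \<Rightarrow> 'a) \<Rightarrow> ('a \<Rightarrow> real) set \<Rightarrow> ('a \<Rightarrow> 'a) topology" where
  "qb_topology cscale P = topology_generated_by
     (insert (quotient_bounded cscale P)
       {{S \<in> quotient_bounded cscale P. op_seminorm p (\<lambda>x. S x - T x) < e} | p T e.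
          p \<in> P \<and> T \<in> quotient_bounded cscale P \<and> e > 0})"

(* Boundedness in the topological vector space sense: every neighbourhood of 0 absorbs B. *)
definition qb_bounded ::
  "(complex \<Rightarrow> 'a::ab_group_add \<Rightarrow> 'a) \<Rightarrow> ('a \<Rightarrow> real) set \<Rightarrow> ('a \<Rightarrow> 'a) set \<Rightarrow> bool" where
  "qb_bounded cscale P B \<longleftrightarrow>
     B \<subseteq> quotient_bounded cscale P \<and>
     (\<forall>U. openin (qb_topology cscale P) U \<and> (\<lambda>x. 0) \<in> U \<longrightarrow>
        (\<exists>s>0. \<forall>c. cmod c \<ge> s \<longrightarrow> B \<subseteq> (\<lambda>S x. cscale c (S x)) ` U))"

definition bounded_elements ::
  "(complex \<Rightarrow> 'a::ab_group_add \<Rightarrow> 'a) \<Rightarrow> ('a \<Rightarrow> real) set \<Rightarrow> ('a \<Rightarrow> 'a) set" where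
  "bounded_elements cscale P =
     {T \<in> quotient_bounded cscale P.
        \<exists>c. c \<noteq> 0 \<and> qb_bounded cscale P {(\<lambda>x. cscale c (T x)) ^^ n | n. n \<ge> 1}}"

definition spectral_radius ::
  "(complex \<Rightarrow> 'a::ab_group_add \<Rightarrow> 'a) \<Rightarrow> ('a \<Rightarrow> real) set \<Rightarrow> ('a \<Rightarrow> 'a) \<Rightarrow> ereal" where
  "spectral_radius cscale P T =
     Inf {ereal \<alpha> | \<alpha>. \<alpha> > 0 \<and>
            qb_bounded cscale P {(\<lambda>x. cscale (inverse (of_real \<alpha>)) (T x)) ^^ n | n. n \<ge> 1}}"

(* R(z,T); meaningful only when z I - T is bijective. *)
definition resolvent ::
  "(complex \<Rightarrow> 'a::ab_group_add \<Rightarrow> 'a) \<Rightarrow> complex \<Rightarrow> ('a \<Rightarrow> 'a) \<Rightarrow> 'a \<Rightarrow> 'a" where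
  "resolvent cscale z T = inv (\<lambda>x. cscale z x - T x)"

definition neumann_partial_sum ::
  "(complex \<Rightarrow> 'a::ab_group_add \<Rightarrow> 'a) \<Rightarrow> complex \<Rightarrow> ('a \<Rightarrow> 'a) \<Rightarrow> nat \<Rightarrow> 'a \<Rightarrow> 'a" where
  "neumann_partial_sum cscale z T N = (\<lambda>x. \<Sum>n\<le>N. cscale (1 / z ^ (n + 1)) ((T ^^ n) x))"

end

theory Submission
  imports Defs
begin

text \<open>
  Choose \<alpha> between the spectral radius and |z|. Boundedness of the powers of T / \<alpha> gives, for each
  seminorm p of the calibration, p (T^n x) \<le> M \<alpha>^n p x, so that the Neumann series is dominated by
  a geometric series with ratio \<alpha> / |z| times p x. It therefore converges pointwise by sequential
  completeness, and the tail estimate is uniform in x up to the factor p x, which is exactly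
  convergence in the seminorms of the algebra. Telescoping identifies the limit as a two-sided inverse.
\<close>

section \<open>Operator seminorms and limits in generated topologies\<close>

lemma power_scaled_linear:
  assumes "Vector_Spaces.linear s s T"
  shows "((\<lambda>x. s a (T x)) ^^ n) x = s (a ^ n) ((T ^^ n) x)"
proof -
  interpret Vector_Spaces.linear s s T by fact
  show ?thesis
    by (induction n) (simp_all add: scale mult.commute)
qed

lemma op_seminorm_le:
  assumes "0 < r" "\<And>x. p (T x) \<le> r * p x"
  shows "op_seminorm p T \<le> r"
  unfolding op_seminorm_def
  by (rule cInf_lower) (use assms in \<open>auto intro!: bdd_belowI[of _ 0]\<close>)

text \<open>The bound \<open>c\<close> makes the set under the infimum nonempty; the real
  \<open>Inf\<close> of the empty set would say nothing about bounds.\<close>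

lemma op_seminorm_lessE:
  assumes "op_seminorm p T < e" "0 < c" "\<And>x. p (T x) \<le> c * p x"
  obtains r where "0 < r" "r < e" "\<And>x. p (T x) \<le> r * p x"
proof -
  have "{r. r > 0 \<and> (\<forall>x. p (T x) \<le> r * p x)} \<noteq> {}"
    using assms(2,3) by blast
  from cInf_lessD[OF this assms(1)[unfolded op_seminorm_def]] show ?thesis
    using that by blast
qed

text \<open>Eventual membership is closed under finite conjunctions, and for a union containing
  \<open>l\<close> a single member containing \<open>l\<close> suffices. So convergence can be
  tested on the generators alone.\<close>

lemma limitin_topology_generated_by:
  assumes "l \<in> \<Union>S" "\<And>U. U \<in> S \<Longrightarrow> l \<in> U \<Longrightarrow> \<forall>\<^sub>F n in F. f n \<in> U"
  shows "limitin (topology_generated_by S) f l F"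
proof -
  have "\<forall>\<^sub>F n in F. f n \<in> U" if "generate_topology_on S U" "l \<in> U" for U
    using that
  proof (induction rule: generate_topology_on.induct)
    case (Int a b)
    then show ?case by (simp add: eventually_conj_iff)
  next
    case (UN K)
    then obtain k where k: "k \<in> K" "l \<in> k" by blast
    then have "\<forall>\<^sub>F n in F. f n \<in> k" using UN by blast
    then show ?case by (rule eventually_mono) (use k in blast)
  qed (use assms(2) in auto)
  then show ?thesis
    using assms(1)
    by (auto simp: limitin_def openin_topology_generated_by_iff)
qed

section \<open>Seminorms of a calibration and the topology of the space\<close>

locale calibrated_space = locally_convex_space cscale
  for cscale :: "complex \<Rightarrow> 'a::{topological_ab_group_add, t2_space} \<Rightarrow> 'a" +
  fixes P :: "('a \<Rightarrow> real) set"
  assumes calibration: "calibration cscale P"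
begin

lemma seminorm_nonneg: "p \<in> P \<Longrightarrow> 0 \<le> p x"
  and seminorm_triangle: "p \<in> P \<Longrightarrow> p (x + y) \<le> p x + p y"
  and seminorm_scale: "p \<in> P \<Longrightarrow> p (cscale c x) = cmod c * p x"
  using calibration by (auto simp: calibration_def is_seminorm_def)

lemma seminorm_zero: "p \<in> P \<Longrightarrow> p 0 = 0"
  using seminorm_scale[of p 0 0] by simp

lemma seminorm_minus: "p \<in> P \<Longrightarrow> p (- x) = p x"
  using seminorm_scale[of p "-1" x] by simp

lemma seminorm_diff_triangle: "p \<in> P \<Longrightarrow> p (x - y) \<le> p x + p y"
  using seminorm_triangle[of p x "- y"] seminorm_minus[of p y] by simp

lemma seminorm_ball_nhd:
  assumes "p \<in> P" "0 < e"
  obtains U where "open U" "0 \<in> U" "\<And>x. x \<in> U \<Longrightarrow> p x < e"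
proof -
  have "\<forall>p\<in>P. \<forall>e>0. \<exists>U. open U \<and> 0 \<in> U \<and> U \<subseteq> {x. p x < e}"
    using calibration by (simp add: calibration_def)
  then obtain U where "open U" "0 \<in> U" "U \<subseteq> {x. p x < e}"
    using assms by meson
  then show ?thesis using that by blast
qed

lemma nhd_contains_seminorm_balls:
  assumes "open U" "0 \<in> U"
  obtains F where "finite F" "\<And>p e. (p, e) \<in> F \<Longrightarrow> p \<in> P \<and> 0 < e"
    "\<And>x. (\<And>p e. (p, e) \<in> F \<Longrightarrow> p x < e) \<Longrightarrow> x \<in> U"
proof -
  have "\<forall>U. open U \<and> 0 \<in> U \<longrightarrow>
      (\<exists>F. finite F \<and> F \<subseteq> P \<times> {0<..} \<and> (\<Inter>(p, e)\<in>F. {x. p x < e}) \<subseteq> U)"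
    using calibration by (simp add: calibration_def)
  then obtain F where F: "finite F" "F \<subseteq> P \<times> {0<..}" "(\<Inter>(p, e)\<in>F. {x. p x < e}) \<subseteq> U"
    using assms by meson
  show ?thesis
  proof (rule that[of F])
    show "x \<in> U" if "\<And>p e. (p, e) \<in> F \<Longrightarrow> p x < e" for x
      using that F(3) by auto
  qed (use F in auto)
qed

text \<open>A point at which all seminorms vanish lies in every finite intersection of seminorm
  balls, hence in every neighbourhood of 0; Hausdorff separation leaves only 0.\<close>

lemma seminorms_zero_imp_zero:
  assumes "\<And>p. p \<in> P \<Longrightarrow> p x = 0"
  shows "x = 0"
proof (rule ccontr)
  assume "x \<noteq> 0"
  then obtain U V where U: "open U" "0 \<in> U" "x \<in> V" "U \<inter> V = {}"
    by (metis hausdorff)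
  obtain F where F: "finite F" "\<And>p e. (p, e) \<in> F \<Longrightarrow> p \<in> P \<and> 0 < e"
    "\<And>x. (\<And>p e. (p, e) \<in> F \<Longrightarrow> p x < e) \<Longrightarrow> x \<in> U"
    using nhd_contains_seminorm_balls[OF U(1,2)] by metis
  have "x \<in> U"
    by (rule F(3)) (metis F(2) assms)
  then show False using U by blast
qed

lemma tvs_Cauchy_seminormI:
  assumes "\<And>p e. p \<in> P \<Longrightarrow> 0 < e \<Longrightarrow> \<exists>N. \<forall>m\<ge>N. \<forall>n\<ge>N. p (u m - u n) < e"
  shows "tvs_Cauchy u"
  unfolding tvs_Cauchy_def
proof (intro allI impI, elim conjE)
  fix U :: "'a set" assume "open U" "0 \<in> U"
  then obtain F where F: "finite F" "\<And>p e. (p, e) \<in> F \<Longrightarrow> p \<in> P \<and> 0 < e"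
    "\<And>x. (\<And>p e. (p, e) \<in> F \<Longrightarrow> p x < e) \<Longrightarrow> x \<in> U"
    using nhd_contains_seminorm_balls by metis
  have "\<forall>p e. \<exists>N. (p, e) \<in> F \<longrightarrow> (\<forall>m\<ge>N. \<forall>n\<ge>N. p (u m - u n) < e)"
    using F(2) assms by meson
  then obtain N where N: "\<And>p e m n. (p, e) \<in> F \<Longrightarrow> N p e \<le> m \<Longrightarrow> N p e \<le> n \<Longrightarrow> p (u m - u n) < e"
    by metis
  \<comment> \<open>Only finitely many pairs constrain the index, so their maximum exists; the
    inserted 0 keeps \<open>Max\<close> meaningful when \<open>F\<close> is empty.\<close>
  define K where "K = Max (insert 0 ((\<lambda>(p, e). N p e) ` F))"
  have K: "N p e \<le> K" if "(p, e) \<in> F" for p e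
    unfolding K_def by (rule Max_ge) (use F(1) that in force)+
  have "u m - u n \<in> U" if "K \<le> m" "K \<le> n" for m n
    by (rule F(3)) (meson K N le_trans that)
  then show "\<exists>N. \<forall>m\<ge>N. \<forall>n\<ge>N. u m - u n \<in> U" by blast
qed

lemma LIMSEQ_seminormD:
  assumes "u \<longlonglongrightarrow> l" "p \<in> P" "0 < e"
  shows "\<forall>\<^sub>F n in sequentially. p (l - u n) < e"
proof -
  obtain U where U: "open U" "0 \<in> U" "\<And>x. x \<in> U \<Longrightarrow> p x < e"
    using seminorm_ball_nhd[OF assms(2,3)] by blast
  have "(\<lambda>n. l - u n) \<longlonglongrightarrow> l - l"
    by (intro tendsto_diff tendsto_const assms(1))
  then have "\<forall>\<^sub>F n in sequentially. l - u n \<in> U"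
    using U by (simp add: topological_tendstoD)
  then show ?thesis by (rule eventually_mono) (rule U(3))
qed

section \<open>Sequences with geometrically decaying increments\<close>

lemma geometric_increments_diff_le:
  assumes p: "p \<in> P" and q: "0 \<le> q" "q < 1" and le: "\<And>n. p (u (Suc n) - u n) \<le> C * q ^ n"
  shows "p (u (m + k) - u m) \<le> C / (1 - q) * (q ^ m - q ^ (m + k))"
\<comment> \<open>Keeping the exact partial geometric sum, with its subtracted term
  \<open>q ^ (m + k)\<close>, turns the induction step into an identity; the bound
  \<open>C / (1 - q) * q ^ m\<close> alone would not be inductive.\<close>
proof (induction k)
  case 0
  then show ?case by (simp add: seminorm_zero[OF p])
next
  case (Suc k)
  have "p (u (m + Suc k) - u m) \<le> p (u (Suc (m + k)) - u (m + k)) + p (u (m + k) - u m)"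
    using seminorm_triangle[OF p, of "u (Suc (m + k)) - u (m + k)" "u (m + k) - u m"] by simp
  also have "\<dots> \<le> C * q ^ (m + k) + C / (1 - q) * (q ^ m - q ^ (m + k))"
    using le[of "m + k"] Suc by linarith
  also have "\<dots> = C / (1 - q) * (q ^ m - q ^ (m + Suc k))"
    using q by (simp add: field_simps)
  finally show ?case .
qed

text \<open>The error at \<open>m\<close> is compared with that at a far index \<open>n\<close>,
  where \<open>p (l - u n)\<close> is below an arbitrary \<open>e\<close>; the bound on
  \<open>u n - u m\<close> is uniform in \<open>n\<close>.\<close>

lemma geometric_increments_limit_le:
  assumes p: "p \<in> P" and q: "0 \<le> q" "q < 1" and le: "\<And>n. p (u (Suc n) - u n) \<le> C * q ^ n"
    and lim: "u \<longlonglongrightarrow> l"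
  shows "p (l - u m) \<le> C / (1 - q) * q ^ m"
proof (rule field_le_epsilon)
  fix e :: real assume "0 < e"
  \<comment> \<open>The increment bound at index 0 forces this sign, which allows the term
    \<open>- q ^ n\<close> to be dropped below.\<close>
  have C: "0 \<le> C"
    using le[of 0] seminorm_nonneg[OF p, of "u (Suc 0) - u 0"] by simp
  have "\<forall>\<^sub>F n in sequentially. p (l - u n) < e \<and> m \<le> n"
    using LIMSEQ_seminormD[OF lim p \<open>0 < e\<close>] eventually_ge_at_top by (rule eventually_conj)
  then obtain n where n: "p (l - u n) < e" "m \<le> n"
    using eventually_sequentially by auto
  have "p (l - u m) \<le> p (l - u n) + p (u n - u m)"
    using seminorm_triangle[OF p, of "l - u n" "u n - u m"] by simp
  also have "p (u n - u m) \<le> C / (1 - q) * (q ^ m - q ^ n)"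
    using geometric_increments_diff_le[OF p q le, of m "n - m"] n(2) by simp
  also have "\<dots> \<le> C / (1 - q) * q ^ m"
    using C q by (intro mult_left_mono) auto
  finally show "p (l - u m) \<le> C / (1 - q) * q ^ m + e"
    using n(1) by simp
qed

lemma tvs_Cauchy_geometric:
  assumes "\<And>p. p \<in> P \<Longrightarrow> \<exists>C q. 0 \<le> q \<and> q < 1 \<and> (\<forall>n. p (u (Suc n) - u n) \<le> C * q ^ n)"
  shows "tvs_Cauchy u"
proof (rule tvs_Cauchy_seminormI)
  fix p and e :: real assume p: "p \<in> P" and "0 < e"
  obtain C q where q: "0 \<le> q" "q < 1" and le: "\<And>n. p (u (Suc n) - u n) \<le> C * q ^ n"
    using assms[OF p] by blast
  have C: "0 \<le> C"
    using le[of 0] seminorm_nonneg[OF p, of "u (Suc 0) - u 0"] by simp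
  have "(\<lambda>n. C / (1 - q) * q ^ n) \<longlonglongrightarrow> C / (1 - q) * 0"
    using q by (intro tendsto_mult tendsto_const LIMSEQ_realpow_zero)
  then have "\<forall>\<^sub>F n in sequentially. C / (1 - q) * q ^ n < e / 2"
    by (rule order_tendstoD) (use \<open>0 < e\<close> in simp)
  then obtain N where N: "C / (1 - q) * q ^ N < e / 2"
    using eventually_sequentially by auto
  \<comment> \<open>Comparing both indices with the fixed \<open>u N\<close> avoids a case
    distinction on their order.\<close>
  have tail: "p (u m - u N) < e / 2" if "N \<le> m" for m
  proof -
    have "p (u m - u N) \<le> C / (1 - q) * (q ^ N - q ^ m)"
      using geometric_increments_diff_le[OF p q le, of N "m - N"] that by simp
    also have "\<dots> \<le> C / (1 - q) * q ^ N"
      using C q by (intro mult_left_mono) auto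
    finally show ?thesis using N by linarith
  qed
  have "p (u m - u n) < e" if "N \<le> m" "N \<le> n" for m n
    using seminorm_diff_triangle[OF p, of "u m - u N" "u n - u N"] tail[OF that(1)] tail[OF that(2)]
    by simp
  then show "\<exists>N. \<forall>m\<ge>N. \<forall>n\<ge>N. p (u m - u n) < e" by blast
qed

section \<open>Quotient bounded operators and their topology\<close>

lemma zero_quotient_bounded: "(\<lambda>x. 0) \<in> quotient_bounded cscale P"
proof -
  have "Vector_Spaces.linear cscale cscale (\<lambda>x. 0)"
    by unfold_locales auto
  moreover have "\<exists>c>0. \<forall>x. p 0 \<le> c * p x" if "p \<in> P" for p
    using that by (intro exI[of _ 1]) (simp add: seminorm_zero seminorm_nonneg)
  ultimately show ?thesis by (simp add: quotient_bounded_def)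
qed

lemma quotient_bounded_linear:
  "T \<in> quotient_bounded cscale P \<Longrightarrow> Vector_Spaces.linear cscale cscale T"
  by (simp add: quotient_bounded_def)

lemma quotient_boundedE:
  assumes "T \<in> quotient_bounded cscale P" "p \<in> P"
  obtains c where "0 < c" "\<And>x. p (T x) \<le> c * p x"
  using assms by (auto simp: quotient_bounded_def)

text \<open>Supplies the a priori bound with which \<open>op_seminorm_lessE\<close> can be applied
  to a difference of operators.\<close>

lemma quotient_bounded_diff_boundE:
  assumes "S \<in> quotient_bounded cscale P" "T \<in> quotient_bounded cscale P" "p \<in> P"
  obtains c where "0 < c" "\<And>x. p (S x - T x) \<le> c * p x"
proof -
  obtain a where a: "0 < a" "\<And>x. p (S x) \<le> a * p x"
    using quotient_boundedE[OF assms(1,3)] by blast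
  obtain b where b: "0 < b" "\<And>x. p (T x) \<le> b * p x"
    using quotient_boundedE[OF assms(2,3)] by blast
  have "p (S x - T x) \<le> (a + b) * p x" for x
    using seminorm_diff_triangle[OF assms(3), of "S x" "T x"] a(2)[of x] b(2)[of x]
    by (simp add: distrib_right)
  then show ?thesis using that[of "a + b"] a(1) b(1) by simp
qed

text \<open>The unit ball of \<open>op_seminorm p\<close> is a neighbourhood of the zero operator,
  so it absorbs \<open>B\<close>; the absorbing factor \<open>s\<close> serves as
  \<open>M\<close>.\<close>

lemma qb_bounded_imp_uniform_bound:
  assumes "qb_bounded cscale P B" "p \<in> P"
  obtains M where "0 < M" "\<And>S x. S \<in> B \<Longrightarrow> p (S x) \<le> M * p x"
proof -
  \<comment> \<open>The difference to the zero operator is spelled out to match the shape of the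
    generators of \<open>qb_topology\<close>.\<close>
  let ?U = "{S \<in> quotient_bounded cscale P. op_seminorm p (\<lambda>x. S x - (\<lambda>x. 0) x) < 1}"
  have "openin (qb_topology cscale P) ?U"
    unfolding qb_topology_def
    by (rule topology_generated_by_Basis)
      (intro insertI2 CollectI exI[of _ p] exI[of _ "\<lambda>x. 0"] exI[of _ 1],
        use assms(2) zero_quotient_bounded in simp)
  \<comment> \<open>\<open>op_seminorm_le\<close> asks for a positive bound; any value strictly
    between 0 and 1 puts the zero operator into \<open>?U\<close>.\<close>
  moreover have "op_seminorm p (\<lambda>x. 0) \<le> 1 / 2"
    by (rule op_seminorm_le) (use assms(2) in \<open>auto simp: seminorm_zero seminorm_nonneg\<close>)
  then have "(\<lambda>x. 0) \<in> ?U"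
    using zero_quotient_bounded by simp
  ultimately obtain s where s: "s > 0"
    and sub: "\<And>c. cmod c \<ge> s \<Longrightarrow> B \<subseteq> (\<lambda>S x. cscale c (S x)) ` ?U"
    using assms(1) unfolding qb_bounded_def by blast
  have "p (S x) \<le> s * p x" if SB: "S \<in> B" for S x
  proof -
    obtain S' where S': "S' \<in> quotient_bounded cscale P" "op_seminorm p S' < 1"
      and S: "S = (\<lambda>x. cscale (of_real s) (S' x))"
      using subsetD[OF sub SB, of "of_real s"] s by auto
    obtain c where "0 < c" "\<And>x. p (S' x) \<le> c * p x"
      using quotient_boundedE[OF S'(1) assms(2)] by blast
    then obtain r where r: "r < 1" "\<And>x. p (S' x) \<le> r * p x"
      using op_seminorm_lessE[OF S'(2)] by metis
    have "p (S' x) \<le> p x"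
      using r(2)[of x] mult_right_mono[of r 1 "p x"] r(1) seminorm_nonneg[OF assms(2)] by simp
    then show ?thesis
      using s by (simp add: S seminorm_scale[OF assms(2)])
  qed
  then show ?thesis using that s by blast
qed

text \<open>The generators are balls around arbitrary centres \<open>T\<close>. If \<open>R\<close>
  lies in such a ball of radius \<open>e\<close>, then \<open>R - T\<close> has a bound
  \<open>r < e\<close>, and the slack \<open>e - r\<close> leaves room for
  \<open>S n - R\<close>.\<close>

lemma limitin_qb_topologyI:
  assumes R: "R \<in> quotient_bounded cscale P"
    and S: "\<And>n. S n \<in> quotient_bounded cscale P"
    and bound: "\<And>p. p \<in> P \<Longrightarrow> \<exists>\<epsilon>. \<epsilon> \<longlonglongrightarrow> 0 \<and> (\<forall>n x. p (S n x - R x) \<le> \<epsilon> n * p x)"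
  shows "limitin (qb_topology cscale P) S R sequentially"
  unfolding qb_topology_def
proof (rule limitin_topology_generated_by)
  fix U
  assume U: "U \<in> insert (quotient_bounded cscale P)
       {{S \<in> quotient_bounded cscale P. op_seminorm p (\<lambda>x. S x - T x) < e} | p T e.
          p \<in> P \<and> T \<in> quotient_bounded cscale P \<and> e > 0}" and RU: "R \<in> U"
  show "\<forall>\<^sub>F n in sequentially. S n \<in> U"
  proof (cases "U = quotient_bounded cscale P")
    case True
    then show ?thesis using S by simp
  next
    case False
    then obtain p T e where p: "p \<in> P" and T: "T \<in> quotient_bounded cscale P"
      and U: "U = {S \<in> quotient_bounded cscale P. op_seminorm p (\<lambda>x. S x - T x) < e}"
      using U by blast
    have "op_seminorm p (\<lambda>x. R x - T x) < e" using RU U by simp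
    then obtain r where r: "0 < r" "r < e" "\<And>x. p (R x - T x) \<le> r * p x"
      using quotient_bounded_diff_boundE[OF R T p] op_seminorm_lessE[of p "\<lambda>x. R x - T x" e] by metis
    obtain \<epsilon> where eps: "\<epsilon> \<longlonglongrightarrow> 0" "\<And>n x. p (S n x - R x) \<le> \<epsilon> n * p x"
      using bound[OF p] by blast
    have "\<forall>\<^sub>F n in sequentially. \<epsilon> n < (e - r) / 2"
      by (rule order_tendstoD(2)[OF eps(1)]) (use r(2) in simp)
    then show ?thesis
    proof (rule eventually_mono)
      fix n assume n: "\<epsilon> n < (e - r) / 2"
      \<comment> \<open>Half of the slack pays for \<open>S n - R\<close>; the other half keeps the
        total strictly below \<open>e\<close>.\<close>
      have "op_seminorm p (\<lambda>x. S n x - T x) \<le> (e - r) / 2 + r"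
      proof (rule op_seminorm_le)
        fix x
        have "p (S n x - T x) \<le> p (S n x - R x) + p (R x - T x)"
          using seminorm_triangle[OF p, of "S n x - R x" "R x - T x"] by simp
        also have "\<dots> \<le> \<epsilon> n * p x + r * p x"
          using eps(2) r(3) by (intro add_mono)
        also have "\<dots> \<le> (e - r) / 2 * p x + r * p x"
          using n seminorm_nonneg[OF p] by (intro add_mono mult_right_mono) auto
        finally show "p (S n x - T x) \<le> ((e - r) / 2 + r) * p x"
          by (simp only: distrib_right)
      qed (use r in \<open>simp add: field_simps\<close>)
      then show "S n \<in> U" using S r(2) by (simp add: U field_simps)
    qed
  qed
qed (use R in blast)

section \<open>Partial sums of the Neumann series\<close>

lemma neumann_partial_sum_quotient_bounded:
  assumes "T \<in> quotient_bounded cscale P"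
  shows "neumann_partial_sum cscale z T N \<in> quotient_bounded cscale P"
proof -
  interpret T: Vector_Spaces.linear cscale cscale T
    using assms by (rule quotient_bounded_linear)
  have pow: "(T ^^ n) (x + y) = (T ^^ n) x + (T ^^ n) y"
    "(T ^^ n) (cscale c x) = cscale c ((T ^^ n) x)" for n x y c
    by (induction n) (simp_all add: T.add T.scale)
  have lin: "Vector_Spaces.linear cscale cscale (neumann_partial_sum cscale z T N)"
    by unfold_locales
      (simp_all add: neumann_partial_sum_def pow scale_right_distrib sum.distrib
        scale_sum_right mult.commute)
  have "\<exists>c>0. \<forall>x. p (neumann_partial_sum cscale z T N x) \<le> c * p x" if p: "p \<in> P" for p
  proof -
    obtain c where c: "0 < c" "\<And>x. p (T x) \<le> c * p x"
      using quotient_boundedE[OF assms p] by blast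
    have pow_le: "p ((T ^^ n) x) \<le> c ^ n * p x" for n x
    proof (induction n)
      case (Suc n)
      have "p ((T ^^ Suc n) x) \<le> c * p ((T ^^ n) x)" using c(2) by simp
      also have "\<dots> \<le> c * (c ^ n * p x)" using Suc c(1) by simp
      finally show ?case by (simp add: mult.assoc)
    qed simp
    let ?C = "\<lambda>N. \<Sum>n\<le>N. cmod (1 / z ^ (n + 1)) * c ^ n"
    have le: "p (neumann_partial_sum cscale z T N x) \<le> ?C N * p x" for x
    proof (induction N)
      case 0
      then show ?case by (simp add: neumann_partial_sum_def seminorm_scale[OF p])
    next
      case (Suc N)
      let ?t = "cscale (1 / z ^ (Suc N + 1)) ((T ^^ Suc N) x)"
      have "p (neumann_partial_sum cscale z T (Suc N) x) \<le> p (neumann_partial_sum cscale z T N x) + p ?t"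
        unfolding neumann_partial_sum_def sum.atMost_Suc by (rule seminorm_triangle[OF p])
      also have "p ?t \<le> cmod (1 / z ^ (Suc N + 1)) * (c ^ Suc N * p x)"
        unfolding seminorm_scale[OF p] by (intro mult_left_mono pow_le) simp
      finally show ?case
        using Suc unfolding sum.atMost_Suc distrib_right mult.assoc by linarith
    qed
    have "0 \<le> ?C N" using c(1) by (intro sum_nonneg) simp
    \<comment> \<open>Adding 1 yields the strictly positive constant that
      \<open>quotient_bounded\<close> demands: for \<open>z = 0\<close> the sum \<open>?C N\<close>
      is 0, because division by 0 gives 0.\<close>
    moreover have "p (neumann_partial_sum cscale z T N x) \<le> (?C N + 1) * p x" for x
      using le[of x] seminorm_nonneg[OF p, of x] by (simp add: distrib_right)
    ultimately show ?thesis by (intro exI[of _ "?C N + 1"]) auto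
  qed
  then show ?thesis using lin by (simp add: quotient_bounded_def)
qed

text \<open>With \<open>d n\<close> the term \<open>T ^^ n\<close> applied to \<open>x\<close> and
  divided by \<open>z ^ n\<close>, multiplying a summand by \<open>z I - T\<close> on either side
  gives \<open>d n - d (Suc n)\<close>, because \<open>T\<close> commutes with its powers. Both
  orders are needed for a two-sided inverse.\<close>

lemma neumann_partial_sum_telescope:
  assumes "Vector_Spaces.linear cscale cscale T" "z \<noteq> 0"
  shows "neumann_partial_sum cscale z T N (cscale z x - T x) =
      x - cscale (1 / z ^ Suc N) ((T ^^ Suc N) x)" (is ?right)
    and "cscale z (neumann_partial_sum cscale z T N x) - T (neumann_partial_sum cscale z T N x) =
      x - cscale (1 / z ^ Suc N) ((T ^^ Suc N) x)" (is ?left)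
proof -
  interpret T: Vector_Spaces.linear cscale cscale T by fact
  define d where "d n = cscale (1 / z ^ n) ((T ^^ n) x)" for n
  have pow: "(T ^^ n) (u - v) = (T ^^ n) u - (T ^^ n) v"
    "(T ^^ n) (cscale c u) = cscale c ((T ^^ n) u)" for n u v c
    by (induction n) (simp_all add: T.diff T.scale)
  have "(\<Sum>n\<le>N. d n - d (Suc n)) = x - d (Suc N)"
    using sum_telescope[of d N] by (simp add: d_def atMost_atLeast0)
  moreover have "neumann_partial_sum cscale z T N (cscale z x - T x) = (\<Sum>n\<le>N. d n - d (Suc n))"
    using assms(2)
    by (simp add: neumann_partial_sum_def d_def pow scale_right_diff_distrib funpow_swap1)
  moreover have "cscale z (neumann_partial_sum cscale z T N x) - T (neumann_partial_sum cscale z T N x)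
      = (\<Sum>n\<le>N. d n - d (Suc n))"
    using assms(2)
    by (simp add: neumann_partial_sum_def d_def T.sum T.scale scale_sum_right sum_subtractf)
  ultimately show ?right ?left by (simp_all add: d_def)
qed

section \<open>Convergence of the Neumann series and identification of its limit\<close>

lemma neumann_series:
  assumes complete: "sequentially_complete TYPE('a)"
    and T: "T \<in> quotient_bounded cscale P"
    and \<alpha>: "0 < \<alpha>" "\<alpha> < cmod z"
    and bounded: "qb_bounded cscale P {(\<lambda>x. cscale (inverse (of_real \<alpha>)) (T x)) ^^ n | n. n \<ge> 1}"
  shows "bij (\<lambda>x. cscale z x - T x)"
    and "resolvent cscale z T \<in> quotient_bounded cscale P"
    and "limitin (qb_topology cscale P) (neumann_partial_sum cscale z T) (resolvent cscale z T) sequentially"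
proof -
  interpret T: Vector_Spaces.linear cscale cscale T
    using T by (rule quotient_bounded_linear)
  define q where "q = \<alpha> / cmod z"
  have z: "z \<noteq> 0" and q: "0 \<le> q" "q < 1"
    using \<alpha> by (auto simp: q_def divide_less_eq)
  let ?S = "neumann_partial_sum cscale z T"
  let ?A = "\<lambda>x. cscale z x - T x"
  \<comment> \<open>The exponent is \<open>Suc n\<close> because the bounded family contains only
    the powers with exponent at least 1.\<close>
  have powers: "\<exists>M. 0 \<le> M \<and> (\<forall>n x. p ((T ^^ Suc n) x) \<le> M * \<alpha> ^ Suc n * p x)" if p: "p \<in> P" for p
  proof -
    obtain M where M: "0 < M" "\<And>S x. S \<in> {(\<lambda>x. cscale (inverse (of_real \<alpha>)) (T x)) ^^ n | n. n \<ge> 1}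
        \<Longrightarrow> p (S x) \<le> M * p x"
      using qb_bounded_imp_uniform_bound[OF bounded p] by blast
    have "p ((T ^^ Suc n) x) \<le> M * \<alpha> ^ Suc n * p x" for n x
    proof -
      have "p (((\<lambda>x. cscale (inverse (of_real \<alpha>)) (T x)) ^^ Suc n) x) \<le> M * p x"
        by (rule M(2)) (intro CollectI exI[of _ "Suc n"], simp del: funpow.simps)
      then have "inverse \<alpha> ^ Suc n * p ((T ^^ Suc n) x) \<le> M * p x"
        using \<alpha>(1) unfolding power_scaled_linear[OF T.linear_axioms] seminorm_scale[OF p]
        by (simp add: norm_power norm_mult norm_inverse)
      then show ?thesis
        using \<alpha>(1) by (simp add: power_inverse divide_simps mult_ac del: power_Suc)
    qed
    then show ?thesis using M(1) by (intro exI[of _ M]) auto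
  qed
  \<comment> \<open>The second estimate concerns the remainder of the telescoping identity; dividing
    that remainder by \<open>z\<close> gives the increment of the partial sums, so both share one
    constant.\<close>
  have increments: "\<exists>C\<ge>0. (\<forall>n x. p (?S (Suc n) x - ?S n x) \<le> C * p x * q ^ n)
      \<and> (\<forall>n x. p (cscale (1 / z ^ Suc n) ((T ^^ Suc n) x)) \<le> C * p x * cmod z * q ^ n)"
    if p: "p \<in> P" for p
  proof -
    obtain M where M: "0 \<le> M" "\<And>n x. p ((T ^^ Suc n) x) \<le> M * \<alpha> ^ Suc n * p x"
      using powers[OF p] by blast
    \<comment> \<open>Chosen so that \<open>M * q ^ Suc n = C * cmod z * q ^ n\<close>.\<close>
    define C where "C = M * q / cmod z"
    have summand: "p (cscale (1 / z ^ Suc n) ((T ^^ Suc n) x)) \<le> C * p x * cmod z * q ^ n" for n x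
    proof -
      have "p (cscale (1 / z ^ Suc n) ((T ^^ Suc n) x)) = p ((T ^^ Suc n) x) / cmod z ^ Suc n"
        unfolding seminorm_scale[OF p] by (simp add: norm_divide norm_power norm_mult)
      also have "\<dots> \<le> M * \<alpha> ^ Suc n * p x / cmod z ^ Suc n"
        by (intro divide_right_mono M(2)) simp
      also have "\<dots> = C * p x * cmod z * q ^ n"
        using z by (simp add: C_def q_def power_divide)
      finally show ?thesis .
    qed
    have "p (?S (Suc n) x - ?S n x) \<le> C * p x * q ^ n" for n x
    proof -
      have "?S (Suc n) x - ?S n x = cscale (1 / z) (cscale (1 / z ^ Suc n) ((T ^^ Suc n) x))"
        by (simp add: neumann_partial_sum_def)
      then have "p (?S (Suc n) x - ?S n x) = p (cscale (1 / z ^ Suc n) ((T ^^ Suc n) x)) / cmod z"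
        by (simp only: seminorm_scale[OF p]) (simp add: norm_divide)
      also have "\<dots> \<le> C * p x * cmod z * q ^ n / cmod z"
        by (intro divide_right_mono summand) simp
      finally show ?thesis using z by simp
    qed
    moreover have "0 \<le> C" using M(1) q by (simp add: C_def)
    ultimately show ?thesis using summand by blast
  qed
  have "tvs_Cauchy (\<lambda>n. ?S n x)" for x
    by (rule tvs_Cauchy_geometric) (use increments q in blast)
  then have "\<forall>x. \<exists>l. (\<lambda>n. ?S n x) \<longlonglongrightarrow> l"
    using complete unfolding sequentially_complete_def convergent_def by blast
  \<comment> \<open>\<open>R\<close> is so far only a pointwise limit; its linearity is obtained
    later, from its being the inverse of a linear bijection.\<close>
  then obtain R where R: "\<And>x. (\<lambda>n. ?S n x) \<longlonglongrightarrow> R x"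
    by metis
  \<comment> \<open>One \<open>K\<close> controls the truncation error and the telescoping
    remainder. It does not depend on \<open>x\<close>, which enters only through the factor
    \<open>p x\<close>.\<close>
  have tail: "\<exists>K. \<forall>n x. p (R x - ?S n x) \<le> K * q ^ n * p x
      \<and> p (cscale (1 / z ^ Suc n) ((T ^^ Suc n) x)) \<le> K * q ^ n * p x" if p: "p \<in> P" for p
  proof -
    obtain C where C: "0 \<le> C" "\<And>n x. p (?S (Suc n) x - ?S n x) \<le> C * p x * q ^ n"
      "\<And>n x. p (cscale (1 / z ^ Suc n) ((T ^^ Suc n) x)) \<le> C * p x * cmod z * q ^ n"
      using increments[OF p] by blast
    define K where "K = max (C / (1 - q)) (C * cmod z)"
    have K: "C / (1 - q) * (q ^ n * p x) \<le> K * (q ^ n * p x)"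
      "C * cmod z * (q ^ n * p x) \<le> K * (q ^ n * p x)" for n x
      using q seminorm_nonneg[OF p, of x] unfolding K_def by (intro mult_right_mono; simp)+
    have "p (R x - ?S n x) \<le> K * q ^ n * p x" for n x
      using geometric_increments_limit_le[OF p q C(2) R, of x n] K(1)[of n x] by (simp add: mult_ac)
    moreover have "p (cscale (1 / z ^ Suc n) ((T ^^ Suc n) x)) \<le> K * q ^ n * p x" for n x
      using C(3)[where x=x and n=n] K(2)[of n x] by (simp add: mult_ac)
    ultimately show ?thesis by blast
  qed
  \<comment> \<open>Letting \<open>n\<close> grow makes every seminorm of \<open>y\<close> zero, and
    the seminorms separate points. Both inverse identities reduce to this.\<close>
  have vanish: "y = 0" if le: "\<And>p. p \<in> P \<Longrightarrow> \<exists>K. \<forall>n. p y \<le> K * q ^ n" for y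
  proof (rule seminorms_zero_imp_zero)
    fix p assume p: "p \<in> P"
    then obtain K where K: "\<And>n. p y \<le> K * q ^ n" using le by blast
    have "(\<lambda>n. K * q ^ n) \<longlonglongrightarrow> K * 0"
      using q by (intro tendsto_mult tendsto_const LIMSEQ_realpow_zero)
    then have "p y \<le> 0"
      using LIMSEQ_le_const[of "\<lambda>n. K * q ^ n" "K * 0" "p y"] K by auto
    then show "p y = 0" using seminorm_nonneg[OF p, of y] by simp
  qed
  have RA: "R (?A x) = x" for x
  proof -
    have "R (?A x) - x = 0"
    proof (rule vanish)
      fix p assume p: "p \<in> P"
      obtain K where K: "\<And>n x. p (R x - ?S n x) \<le> K * q ^ n * p x"
        "\<And>n x. p (cscale (1 / z ^ Suc n) ((T ^^ Suc n) x)) \<le> K * q ^ n * p x"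
        using tail[OF p] by blast
      have "p (R (?A x) - x) \<le> (K * p (?A x) + K * p x) * q ^ n" for n
      proof -
        let ?t = "cscale (1 / z ^ Suc n) ((T ^^ Suc n) x)"
        \<comment> \<open>Inserting the partial sum leaves the truncation error at
          \<open>?A x\<close> and, by telescoping, the remainder \<open>?t\<close>.\<close>
        have "R (?A x) - x = (R (?A x) - ?S n (?A x)) - ?t"
          unfolding neumann_partial_sum_telescope(1)[OF T.linear_axioms z] by simp
        then have "p (R (?A x) - x) \<le> p (R (?A x) - ?S n (?A x)) + p ?t"
          by (metis seminorm_diff_triangle[OF p])
        also have "\<dots> \<le> K * q ^ n * p (?A x) + K * q ^ n * p x"
          by (intro add_mono K)
        finally show ?thesis by (simp only: distrib_left distrib_right mult_ac)
      qed
      then show "\<exists>K. \<forall>n. p (R (?A x) - x) \<le> K * q ^ n" by blast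
    qed
    then show ?thesis by simp
  qed
  have AR: "?A (R x) = x" for x
  proof -
    have "?A (R x) - x = 0"
    proof (rule vanish)
      fix p assume p: "p \<in> P"
      obtain K where K: "\<And>n x. p (R x - ?S n x) \<le> K * q ^ n * p x"
        "\<And>n x. p (cscale (1 / z ^ Suc n) ((T ^^ Suc n) x)) \<le> K * q ^ n * p x"
        using tail[OF p] by blast
      obtain c where c: "0 < c" "\<And>x. p (T x) \<le> c * p x"
        using quotient_boundedE[OF T p] by blast
      \<comment> \<open>This bound carries the truncation error \<open>R x - ?S n x\<close> through
        \<open>?A\<close> at the cost of a constant factor, preserving its geometric decay.\<close>
      have A_le: "p (?A y) \<le> (cmod z + c) * p y" for y
        using seminorm_diff_triangle[OF p, of "cscale z y" "T y"] c(2)[of y]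
        by (simp add: seminorm_scale[OF p] distrib_right)
      have "p (?A (R x) - x) \<le> ((cmod z + c) * (K * p x) + K * p x) * q ^ n" for n
      proof -
        let ?t = "cscale (1 / z ^ Suc n) ((T ^^ Suc n) x)"
        have "?A (R x) - ?A (?S n x) = ?A (R x - ?S n x)"
          by (simp add: T.diff scale_right_diff_distrib)
        then have "?A (R x) - x = ?A (R x - ?S n x) - ?t"
          unfolding neumann_partial_sum_telescope(2)[OF T.linear_axioms z] by (simp add: algebra_simps)
        then have "p (?A (R x) - x) \<le> p (?A (R x - ?S n x)) + p ?t"
          using seminorm_diff_triangle[OF p, of "?A (R x - ?S n x)" ?t] by simp
        also have "\<dots> \<le> (cmod z + c) * (K * q ^ n * p x) + K * q ^ n * p x"
          using c(1) by (intro add_mono K order.trans[OF A_le] mult_left_mono) auto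
        finally show ?thesis by (simp only: distrib_left distrib_right mult_ac)
      qed
      then show "\<exists>K. \<forall>n. p (?A (R x) - x) \<le> K * q ^ n" by blast
    qed
    then show ?thesis by simp
  qed
  show bij: "bij ?A"
    by (rule o_bij[of R]) (auto simp: RA AR)
  have res: "resolvent cscale z T = R"
    unfolding resolvent_def by (rule inv_unique_comp) (auto simp: RA AR)
  have S: "?S n \<in> quotient_bounded cscale P" for n
    by (rule neumann_partial_sum_quotient_bounded[OF T])
  interpret pair: module_pair cscale cscale ..
  have "module_hom cscale cscale ?A"
    unfolding module_hom_iff_linear
    by unfold_locales (simp_all add: T.add T.scale scale_right_distrib scale_right_diff_distrib mult.commute)
  then have "module_hom cscale cscale R"
    using pair.bij_module_hom_imp_inv_module_hom[OF _ bij] res by (simp add: resolvent_def)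
  moreover have "\<exists>c>0. \<forall>x. p (R x) \<le> c * p x" if p: "p \<in> P" for p
  proof -
    obtain K where K: "\<And>n x. p (R x - ?S n x) \<le> K * q ^ n * p x"
      using tail[OF p] by blast
    obtain c where c: "0 < c" "\<And>x. p (?S 0 x) \<le> c * p x"
      using quotient_boundedE[OF S p] by blast
    \<comment> \<open>\<open>R\<close> is split at its partial sum of index 0, where the tail factor
      \<open>q ^ 0\<close> is 1. The absolute value is taken because the sign of \<open>K\<close> is
      not recorded.\<close>
    have "p (R x) \<le> (\<bar>K\<bar> + c) * p x" for x
    proof -
      have "p (R x) \<le> p (R x - ?S 0 x) + p (?S 0 x)"
        using seminorm_triangle[OF p, of "R x - ?S 0 x" "?S 0 x"] by simp
      moreover have "K * p x \<le> \<bar>K\<bar> * p x"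
        using seminorm_nonneg[OF p] by (intro mult_right_mono) auto
      ultimately show ?thesis
        using K[of x 0] c(2)[of x] by (simp add: distrib_right)
    qed
    then show ?thesis using c(1) by (intro exI[of _ "\<bar>K\<bar> + c"]) auto
  qed
  ultimately have Rqb: "R \<in> quotient_bounded cscale P"
    by (simp add: quotient_bounded_def module_hom_iff_linear)
  then show "resolvent cscale z T \<in> quotient_bounded cscale P" unfolding res .
  show "limitin (qb_topology cscale P) ?S (resolvent cscale z T) sequentially"
    unfolding res
  proof (rule limitin_qb_topologyI[OF Rqb S])
    fix p assume p: "p \<in> P"
    obtain K where K: "\<And>n x. p (R x - ?S n x) \<le> K * q ^ n * p x"
      using tail[OF p] by blast
    \<comment> \<open>The rate is independent of \<open>x\<close>, which upgrades pointwise
      convergence to convergence in \<open>op_seminorm p\<close>.\<close>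
    have "(\<lambda>n. K * q ^ n) \<longlonglongrightarrow> K * 0"
      using q by (intro tendsto_mult tendsto_const LIMSEQ_realpow_zero)
    moreover have "p (?S n x - R x) \<le> K * q ^ n * p x" for n x
      using K[of x n] seminorm_minus[OF p, of "R x - ?S n x"] by simp
    ultimately show "\<exists>\<epsilon>. \<epsilon> \<longlonglongrightarrow> 0 \<and> (\<forall>n x. p (?S n x - R x) \<le> \<epsilon> n * p x)"
      by (intro exI[of _ "\<lambda>n. K * q ^ n"]) simp
  qed
qed

end

text \<open>Since \<open>resolvent\<close> is defined through \<open>inv\<close>, the conjunct
  \<open>bij\<close> is what makes it the genuine inverse of \<open>z I - T\<close>.\<close>

theorem proposition2p12:
  fixes cscale :: "complex \<Rightarrow> 'a::{topological_ab_group_add, t2_space} \<Rightarrow> 'a"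
    and P :: "('a \<Rightarrow> real) set"
    and T :: "'a \<Rightarrow> 'a"
    and z :: complex
  assumes "locally_convex_space cscale"
    and "sequentially_complete TYPE('a)"
    and "calibration cscale P"
    and "T \<in> bounded_elements cscale P"
    and "ereal (cmod z) > spectral_radius cscale P T"
  shows "bij (\<lambda>x. cscale z x - T x)
    \<and> resolvent cscale z T \<in> quotient_bounded cscale P
    \<and> limitin (qb_topology cscale P) (neumann_partial_sum cscale z T) (resolvent cscale z T) sequentially"
proof -
  interpret calibrated_space cscale P
    using assms(1,3) by (simp add: calibrated_space_def calibrated_space_axioms_def)
  \<comment> \<open>An infimum strictly below \<open>cmod z\<close> has an admissible
    \<open>\<alpha>\<close> below \<open>cmod z\<close>; its positivity also gives
    \<open>z \<noteq> 0\<close>.\<close>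
  obtain \<alpha> where "0 < \<alpha>" "\<alpha> < cmod z"
    "qb_bounded cscale P {(\<lambda>x. cscale (inverse (of_real \<alpha>)) (T x)) ^^ n | n. n \<ge> 1}"
    using assms(5) unfolding spectral_radius_def Inf_less_iff by auto
  moreover have "T \<in> quotient_bounded cscale P"
    using assms(4) by (simp add: bounded_elements_def)
  ultimately show ?thesis
    using neumann_series[OF assms(2)] by blast
qed

end
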